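(* Let $T_i\in\mathcal{B}_A(\mathcal{H})$ for $i=1,2,\dots,n$, and let $\mathbb{T}_{slcirc}=\mathrm{slcirc}(T_1,\dots,T_n)$ be the skew left circulant operator matrix. If $n$ is even, then $$w_{\mathbb{A}}(\mathbb{T}_{slcirc})\le\frac n2\sum_{i=1}^n\|T_i\|_A,$$ and if $n$ is odd, then $$w_{\mathbb{A}}(\mathbb{T}_{slcirc})\le\sum_{i=1}^n w_A(T_i)+\frac{n-1}{2}\sum_{i=1}^n\|T_i\|_A.$$
   Context: $\mathcal{H}$ is a complex Hilbert space with inner product $\langle\cdot,\cdot\rangle$, $\mathcal{B}(\mathcal{H})$ is the algebra of bounded linear operators on $\mathcal{H}$, and $A\in\mathcal{B}(\mathcal{H})$ is a fixed positive operator ($\langle Ax,x\rangle\ge 0$ for all $x$). Put $\langle x,y\rangle_A=\langle Ax,y\rangle$ and $\|x\|_A=\sqrt{\langle x,x\rangle_A}$. $\mathcal{B}_A(\mathcal{H})$ is the set of $T\in\mathcal{B}(\mathcal{H})$ admitting an $A$-adjoint, i.e. for which there is $X\in\mathcal{B}(\mathcal{H})$ with $AX=T^*A$ (equivalently $\mathcal{R}(T^*A)\subseteq\mathcal{R}(A)$). The $A$-operator seminorm is $\|T\|_A=\sup_{x\in\overline{\mathcal{R}(A)},\,x\ne0}\|Tx\|_A/\|x\|_A$ and the $A$-numerical radius is $w_A(T)=\sup\{|\langle Tx,x\rangle_A|: x\in\mathcal{H},\ \|x\|_A=1\}$. $\mathbb{A}$ denotes the $n\times n$ block diagonal operator matrix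 on $\bigoplus_{i=1}^n\mathcal{H}$ all of whose diagonal entries are $A$, and $w_{\mathbb{A}}$ is the numerical radius defined in the same way with $\mathcal{H},A$ replaced by $\bigoplus_{i=1}^n\mathcal{H},\mathbb{A}$. The skew left circulant operator matrix $\mathrm{slcirc}(T_1,\dots,T_n)$ is the $n\times n$ operator matrix obtained from the left circulant matrix by changing the sign of all entries below the anti-diagonal: its $(j,k)$ entry is $T_{j+k-1}$ if $j+k\le n+1$ and $-T_{j+k-1-n}$ if $j+k>n+1$. *)

theory Defs
  imports "HOL-Analysis.Analysis"
begin

section \<open>Complex Hilbert spaces\<close>

class complex_vector = real_vector +
  fixes scaleC :: "complex \<Rightarrow> 'a \<Rightarrow> 'a"  (infixr \<open>*\<^sub>C\<close> 75)
  assumes scaleC_add_right: "c *\<^sub>C (x + y) = c *\<^sub>C x + c *\<^sub>C y"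
    and scaleC_add_left: "(c + d) *\<^sub>C x = c *\<^sub>C x + d *\<^sub>C x"
    and scaleC_scaleC: "c *\<^sub>C d *\<^sub>C x = (c * d) *\<^sub>C x"
    and scaleC_one: "1 *\<^sub>C x = x"
    and scaleR_scaleC: "r *\<^sub>R x = complex_of_real r *\<^sub>C x"

text \<open>
  The inner product is linear in its first and conjugate linear in its second argument.
  Since the norm is real and definite, the axiom \<open>cinner_self\<close> contains the positivity
  and definiteness of the inner product.
\<close>

class complex_inner = complex_vector + real_normed_vector +
  fixes cinner :: "'a \<Rightarrow> 'a \<Rightarrow> complex"
  assumes cinner_commute: "cinner x y = cnj (cinner y x)"
    and cinner_add_left: "cinner (x + y) z = cinner x z + cinner y z"
    and cinner_scaleC_left: "cinner (c *\<^sub>C x) y = c * cinner x y"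
    and cinner_self: "cinner x x = complex_of_real ((norm x)\<^sup>2)"

class chilbert_space = complex_inner + complete_space

text \<open>The direct sum of copies of a Hilbert space, indexed by a finite type.\<close>

instantiation vec :: (complex_vector, finite) complex_vector
begin

definition scaleC_vec :: "complex \<Rightarrow> 'a ^ 'b \<Rightarrow> 'a ^ 'b"
  where "c *\<^sub>C x = (\<chi> i. c *\<^sub>C (x $ i))"

instance
  by standard
    (simp_all add: scaleC_vec_def vec_eq_iff scaleC_add_right scaleC_add_left
      scaleC_scaleC scaleC_one scaleR_scaleC)

end

instantiation vec :: (complex_inner, finite) complex_inner
begin

definition cinner_vec :: "'a ^ 'b \<Rightarrow> 'a ^ 'b \<Rightarrow> complex"
  where "cinner x y = (\<Sum>i\<in>UNIV. cinner (x $ i) (y $ i))"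

instance
proof
  fix x y z :: "'a ^ 'b" and c :: complex
  show "cinner x y = cnj (cinner y x)"
    unfolding cinner_vec_def cnj_sum by (rule sum.cong) (auto intro: cinner_commute)
  show "cinner (x + y) z = cinner x z + cinner y z"
    by (simp add: cinner_vec_def cinner_add_left sum.distrib)
  show "cinner (c *\<^sub>C x) y = c * cinner x y"
    by (simp add: cinner_vec_def scaleC_vec_def cinner_scaleC_left sum_distrib_left)
  have "(norm x)\<^sup>2 = (\<Sum>i\<in>UNIV. (norm (x $ i))\<^sup>2)"
    by (simp add: norm_vec_def L2_set_def sum_nonneg)
  then show "cinner x x = complex_of_real ((norm x)\<^sup>2)"
    by (simp add: cinner_vec_def cinner_self)
qed

end

instance vec :: (chilbert_space, finite) chilbert_space ..


section \<open>Operators on a semi-Hilbertian space\<close>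

definition bounded_clinear :: "('a::complex_inner \<Rightarrow> 'b::complex_inner) \<Rightarrow> bool"
  where "bounded_clinear T \<longleftrightarrow> bounded_linear T \<and> (\<forall>c x. T (c *\<^sub>C x) = c *\<^sub>C T x)"

text \<open>
  The Hilbert space adjoint: for a bounded operator on a Hilbert space, exactly one function
  satisfies the defining identity.
\<close>

definition cadjoint :: "('a::chilbert_space \<Rightarrow> 'a) \<Rightarrow> 'a \<Rightarrow> 'a"
  where "cadjoint T = (THE S. \<forall>x y. cinner (T x) y = cinner x (S y))"

definition positive_operator :: "('a::complex_inner \<Rightarrow> 'a) \<Rightarrow> bool"
  where "positive_operator A \<longleftrightarrow>
    bounded_clinear A \<and> (\<forall>x. cinner (A x) x \<in> \<real>\<^sub>\<ge>\<^sub>0)"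

definition A_bounded_operators :: "('a::chilbert_space \<Rightarrow> 'a) \<Rightarrow> ('a \<Rightarrow> 'a) set"
  where "A_bounded_operators A =
    {T. bounded_clinear T \<and> (\<exists>X. bounded_clinear X \<and> A \<circ> X = cadjoint T \<circ> A)}"

definition A_inner :: "('a::complex_inner \<Rightarrow> 'a) \<Rightarrow> 'a \<Rightarrow> 'a \<Rightarrow> complex"
  where "A_inner A x y = cinner (A x) y"

definition A_norm :: "('a::complex_inner \<Rightarrow> 'a) \<Rightarrow> 'a \<Rightarrow> real"
  where "A_norm A x = sqrt (Re (A_inner A x x))"

text \<open>
  In the two suprema below the element \<open>0\<close> is inserted only to give the supremum of
  the empty set its usual value \<open>0\<close> (the sets are empty exactly when \<open>A = 0\<close>);
  all other members are nonnegative. For \<open>T\<close> in \<open>A_bounded_operators A\<close>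
  both sets are bounded above, so these are genuine suprema of reals.
\<close>

definition A_opnorm :: "('a::complex_inner \<Rightarrow> 'a) \<Rightarrow> ('a \<Rightarrow> 'a) \<Rightarrow> real"
  where "A_opnorm A T =
    Sup (insert 0 {A_norm A (T x) / A_norm A x | x. x \<in> closure (range A) \<and> x \<noteq> 0})"

definition A_numerical_radius :: "('a::complex_inner \<Rightarrow> 'a) \<Rightarrow> ('a \<Rightarrow> 'a) \<Rightarrow> real"
  where "A_numerical_radius A T =
    Sup (insert 0 {cmod (A_inner A (T x) x) | x. A_norm A x = 1})"


section \<open>Operator matrices\<close>

definition operator_matrix ::
    "('a::complex_inner \<Rightarrow> 'a) ^ 'n ^ 'n \<Rightarrow> 'a ^ 'n \<Rightarrow> 'a ^ 'n"
  where "operator_matrix M x = (\<chi> j. \<Sum>k\<in>UNIV. (M $ j $ k) (x $ k))"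

definition block_diag :: "('a::complex_inner \<Rightarrow> 'a) \<Rightarrow> 'a ^ 'n \<Rightarrow> 'a ^ 'n"
  where "block_diag A = operator_matrix (\<chi> j k. if j = k then A else (\<lambda>_. 0))"

text \<open>
  The order on the index type identifies it with \<open>{1, \<dots>, n}\<close>, where
  \<open>n = CARD('n)\<close>: \<open>pos j\<close> is the position of \<open>j\<close>, counted from \<open>1\<close>.
\<close>

definition pos :: "'n::{finite,linorder} \<Rightarrow> nat"
  where "pos j = card {i. i \<le> j}"

definition slcirc ::
    "(nat \<Rightarrow> 'a::complex_inner \<Rightarrow> 'a) \<Rightarrow> ('a, 'n::{finite,linorder}) vec \<Rightarrow> ('a, 'n) vec"
  where "slcirc T = operator_matrix
    (\<chi> j k. if pos j + pos k \<le> CARD('n) + 1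
             then T (pos j + pos k - 1)
             else (\<lambda>x. - T (pos j + pos k - 1 - CARD('n)) x))"

end

theory Submission
  imports Defs
begin

text \<open>
  Why the theorem holds: row \<open>j\<close> of the skew left circulant matrix contains, up to sign, each of
  \<open>T\<^sub>1, \<dots>, T\<^sub>n\<close> exactly once, and the matrix is symmetric in its two indices. Put
  \<open>a\<^sub>j = \<parallel>x\<^sub>j\<parallel>\<^sub>A\<close> for a vector \<open>x\<close> of seminorm \<open>1\<close>, so that \<open>\<Sum>\<^sub>j a\<^sub>j\<^sup>2 = 1\<close>. The
  \<open>(j, k)\<close> entry contributes to the quadratic form at most its operator seminorm times
  \<open>a\<^sub>j a\<^sub>k \<le> (a\<^sub>j\<^sup>2 + a\<^sub>k\<^sup>2) / 2\<close>, and summing over rows and columns gives the bound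
  \<open>\<Sum>\<^sub>i \<parallel>T\<^sub>i\<parallel>\<^sub>A\<close> for every \<open>n\<close> (\<open>slcirc_numerical_radius_le\<close>). If \<open>n\<close> is
  even then \<open>n / 2 \<ge> 1\<close>, and if \<open>n\<close> is odd and greater than \<open>1\<close> then
  \<open>(n - 1) / 2 \<ge> 1\<close>, so this one bound is at least as strong as both claims. For \<open>n = 1\<close>
  the claim bounds the numerical radius of the \<open>1 \<times> 1\<close> matrix \<open>T\<^sub>1\<close> by that of \<open>T\<^sub>1\<close>.

  The work lies in the estimate
  \<open>\<bar>\<langle>T u, v\<rangle>\<^sub>A\<bar> \<le> \<parallel>T\<parallel>\<^sub>A \<parallel>u\<parallel>\<^sub>A \<parallel>v\<parallel>\<^sub>A\<close> for all \<open>u\<close> and \<open>v\<close>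
  (\<open>A_inner_le_A_opnorm\<close>), where two things have to be shown. The supremum that defines
  \<open>\<parallel>T\<parallel>\<^sub>A\<close> is finite: if \<open>X\<close> is an adjoint of \<open>T\<close> for the semi-inner product,
  then \<open>X T\<close> is symmetric for it, and a norm bounded operator that is symmetric for a
  semi-inner product is bounded in the seminorm (\<open>A_symmetric_bounded\<close>). And although the
  supremum runs only over the closure of the range of \<open>A\<close>, it controls \<open>T\<close> everywhere, because the
  Hilbert space is the sum of that closure and the kernel of \<open>A\<close>
  (\<open>range_kernel_decomposition\<close>), and \<open>T\<close> maps the kernel into vectors of seminorm \<open>0\<close>.
  This decomposition and the existence of Hilbert space adjoints are both instances of
  \<open>Riesz_on_closed_subspace\<close>.
\<close>

section \<open>Positive semidefinite forms\<close>

text \<open>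
  The Cauchy-Schwarz inequality is needed twice, for the inner product and for the degenerate form
  induced by \<open>A\<close>, so it is proved without assuming definiteness.
\<close>

locale positive_form =
  fixes B :: "'a::complex_vector \<Rightarrow> 'a \<Rightarrow> complex"
  assumes add_left: "B (x + y) z = B x z + B y z"
    and scaleC_left: "B (c *\<^sub>C x) y = c * B x y"
    and commute: "B x y = cnj (B y x)"
    and nonneg: "0 \<le> Re (B x x)"
begin

lemma add_right: "B x (y + z) = B x y + B x z"
  by (metis add_left commute complex_cnj_add)

lemma scaleC_right: "B x (c *\<^sub>C y) = cnj c * B x y"
  by (metis scaleC_left commute complex_cnj_mult)

lemma scaleR_left: "B (r *\<^sub>R x) y = of_real r * B x y"
  by (simp add: scaleR_scaleC scaleC_left)

lemma scaleR_right: "B x (r *\<^sub>R y) = of_real r * B x y"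
  by (simp add: scaleR_scaleC scaleC_right)

lemma zero_left: "B 0 y = 0"
  using scaleR_left[of 0 0 y] by simp

lemma sum_left: "B (\<Sum>i\<in>I. g i) y = (\<Sum>i\<in>I. B (g i) y)"
  by (induction I rule: infinite_finite_induct) (simp_all add: zero_left add_left)

text \<open>
  Evaluating the form at \<open>x - t b y\<close>, with \<open>b = B x y\<close> and \<open>t\<close> real, gives a nonnegative
  quadratic polynomial in \<open>t\<close>. If \<open>B y y = 0\<close>, the polynomial is affine and can only be
  bounded below when \<open>b = 0\<close>.
\<close>
lemma Cauchy_Schwarz_squared: "(cmod (B x y))\<^sup>2 \<le> Re (B x x) * Re (B y y)"
proof -
  define b where "b = B x y"
  have quadratic: "0 \<le> Re (B x x) - 2 * t * (cmod b)\<^sup>2 + t\<^sup>2 * (cmod b)\<^sup>2 * Re (B y y)" for t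
  proof -
    define s where "s = - complex_of_real t * b"
    have "B (x + s *\<^sub>C y) (x + s *\<^sub>C y)
        = B x x + cnj s * b + s * cnj b + s * cnj s * B y y"
      unfolding b_def using commute[of y x]
      by (simp add: add_left add_right scaleC_left scaleC_right algebra_simps)
    also have "\<dots> = B x x - 2 * t * (b * cnj b) + t\<^sup>2 * (b * cnj b) * B y y"
      by (simp add: s_def algebra_simps power2_eq_square)
    also have "b * cnj b = of_real ((cmod b)\<^sup>2)"
      by (rule complex_norm_square[symmetric])
    finally have "Re (B (x + s *\<^sub>C y) (x + s *\<^sub>C y))
        = Re (B x x) - 2 * t * (cmod b)\<^sup>2 + t\<^sup>2 * (cmod b)\<^sup>2 * Re (B y y)"
      by (simp flip: of_real_power of_real_mult)
    then show ?thesis using nonneg[of "x + s *\<^sub>C y"] by simp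
  qed
  show ?thesis
  proof (cases "Re (B y y) = 0")
    case True
    have "b = 0"
    proof (rule ccontr)
      assume "b \<noteq> 0"
      with quadratic[of "(Re (B x x) + 1) / (2 * (cmod b)\<^sup>2)"] True show False
        by (simp add: field_simps)
    qed
    then show ?thesis using True by (simp add: b_def)
  next
    case False
    with nonneg[of y] have pos: "0 < Re (B y y)" by simp
    with quadratic[of "1 / Re (B y y)"] have "0 \<le> Re (B x x) - (cmod b)\<^sup>2 / Re (B y y)"
      by (simp add: field_simps power2_eq_square)
    then show ?thesis using pos by (simp add: b_def field_simps)
  qed
qed

lemma Cauchy_Schwarz: "cmod (B x y) \<le> sqrt (Re (B x x)) * sqrt (Re (B y y))"
  using real_sqrt_le_mono[OF Cauchy_Schwarz_squared[of x y]] by (simp add: real_sqrt_mult)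

end

section \<open>Riesz representation, projection and adjoint\<close>

interpretation cinner: positive_form cinner
  by standard
    (simp_all add: cinner_add_left cinner_scaleC_left cinner_self flip: cinner_commute)

lemma Re_cinner_self: "Re (cinner x x) = (norm x)\<^sup>2"
  by (simp add: cinner_self)

lemma cinner_bound: "cmod (cinner x y) \<le> norm x * norm y"
  using cinner.Cauchy_Schwarz[of x y] by (simp add: Re_cinner_self)

lemma norm_scaleC: "norm (c *\<^sub>C x) = cmod c * norm (x::'a::complex_inner)"
proof -
  have "(norm (c *\<^sub>C x))\<^sup>2 = Re (c * cnj c * cinner x x)"
    by (simp flip: Re_cinner_self add: cinner.scaleC_left cinner.scaleC_right mult_ac)
  also have "\<dots> = (cmod c * norm x)\<^sup>2"
    by (simp add: cinner_self power_mult_distrib flip: complex_norm_square of_real_power of_real_mult)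
  finally show ?thesis by (simp add: power2_eq_iff_nonneg)
qed

lemma bounded_linear_scaleC: "bounded_linear (\<lambda>x::'a::complex_inner. c *\<^sub>C x)"
proof (rule bounded_linear_intro)
  fix r :: real and x y :: 'a
  show "c *\<^sub>C (x + y) = c *\<^sub>C x + c *\<^sub>C y" by (rule scaleC_add_right)
  show "c *\<^sub>C r *\<^sub>R x = r *\<^sub>R c *\<^sub>C x" by (simp add: scaleR_scaleC scaleC_scaleC mult.commute)
  show "norm (c *\<^sub>C x) \<le> norm x * cmod c" by (simp add: norm_scaleC mult.commute)
qed

lemma bounded_linear_cinner_left: "bounded_linear (\<lambda>x. cinner x y)"
  by (rule bounded_linear_intro[where K = "norm y"])
    (simp_all add: cinner.add_left cinner.scaleR_left scaleR_conv_of_real cinner_bound)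

lemma cinner_eqI:
  assumes "\<And>x. cinner x y = cinner x z"
  shows "y = z"
proof -
  have "cinner (y - z) (y + (- 1) *\<^sub>R z) = 0"
    using assms unfolding cinner.add_right cinner.scaleR_right by simp
  then show ?thesis by (simp add: cinner_self)
qed

lemma norm_add_squared:
  "(norm (x + y))\<^sup>2 = (norm x)\<^sup>2 + 2 * Re (cinner x y) + (norm (y::'a::complex_inner))\<^sup>2"
  using arg_cong[OF cinner_commute[of y x], of Re]
  by (simp flip: Re_cinner_self add: cinner.add_left cinner.add_right)

text \<open>
  The representing vector minimises the functional \<open>q s = \<parallel>s\<parallel>\<^sup>2 - 2 Re (f s)\<close> over \<open>S\<close>.
  The affine part of \<open>q\<close> cancels in the parallelogram law, so minimising sequences are Cauchy,
  and the first variation of \<open>q\<close> at the minimum is the representation of \<open>Re f\<close>. For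
  \<open>S = UNIV\<close> this is the Riesz representation theorem, and for
  \<open>f s = cinner s x\<close> the vector found is the orthogonal projection of \<open>x\<close> to \<open>S\<close>.
\<close>
lemma Riesz_on_closed_subspace:
  fixes S :: "'a::chilbert_space set"
  assumes S: "subspace S" "closed S" and S_scaleC: "\<And>c s. s \<in> S \<Longrightarrow> c *\<^sub>C s \<in> S"
    and f: "bounded_linear f" and f_scaleC: "\<And>c x. f (c *\<^sub>C x) = c * f x"
  obtains y where "y \<in> S" "\<And>s. s \<in> S \<Longrightarrow> f s = cinner s y"
proof -
  interpret f: bounded_linear f by fact
  define q where "q s = (norm s)\<^sup>2 - 2 * Re (f s)" for s
  obtain K where K: "\<And>x. norm (f x) \<le> norm x * K" using f.bounded by blast
  (* q s is at least (norm s - K)^2 - K^2, whence the lower bound. *)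
  have "- K\<^sup>2 \<le> q s" for s
  proof -
    have "Re (f s) \<le> norm s * K" using complex_Re_le_cmod K order_trans by blast
    moreover have "0 \<le> (norm s - K)\<^sup>2" by simp
    ultimately show ?thesis unfolding q_def power2_diff by (simp add: algebra_simps)
  qed
  then have bdd: "bdd_below (q ` S)" by (intro bdd_belowI2) auto
  define m where "m = Inf (q ` S)"
  have m_le: "m \<le> q s" if "s \<in> S" for s
    unfolding m_def using bdd that by (simp add: cInf_lower)
  have "\<exists>s\<in>S. q s < m + inverse (Suc n)" for n :: nat
  proof -
    have "q ` S \<noteq> {}" using subspace_0[OF S(1)] by auto
    from cInf_lessD[OF this, of "m + inverse (Suc n)"] show ?thesis by (auto simp: m_def)
  qed
  then obtain X where X: "\<And>n. X n \<in> S" "\<And>n::nat. q (X n) < m + inverse (Suc n)"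
    by metis
  have parallelogram: "(norm (s - t))\<^sup>2 = 2 * q s + 2 * q t - 4 * q ((1/2) *\<^sub>R (s + t))" for s t
  proof -
    have "(norm (s - t))\<^sup>2 = (norm s)\<^sup>2 - 2 * Re (cinner s t) + (norm t)\<^sup>2"
      using norm_add_squared[of s "(-1) *\<^sub>R t"] cinner.scaleR_right[of s "-1" t] by simp
    moreover have "(norm ((1/2) *\<^sub>R (s + t)))\<^sup>2 = (norm (s + t))\<^sup>2 / 4"
      by (simp add: power_divide)
    ultimately show ?thesis
      unfolding q_def f.scaleR f.add using norm_add_squared[of s t]
      by (simp add: power_divide field_simps)
  qed
  have "Cauchy X"
  proof (rule metric_CauchyI)
    fix e :: real assume "0 < e"
    then obtain N where N: "inverse (real (Suc N)) < e\<^sup>2 / 4"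
      using reals_Archimedean[of "e\<^sup>2 / 4"] by auto
    have "dist (X i) (X j) < e" if "i \<ge> N" "j \<ge> N" for i j
    proof -
      have mono: "inverse (real (Suc k)) \<le> inverse (real (Suc N))" if "k \<ge> N" for k
        using that by (intro le_imp_inverse_le) auto
      have "(1/2) *\<^sub>R (X i + X j) \<in> S"
        using X(1) S(1) by (simp add: subspace_add subspace_scale)
      from m_le[OF this] have "(norm (X i - X j))\<^sup>2 < e\<^sup>2"
        using parallelogram[of "X i" "X j"] X(2)[of i] X(2)[of j] mono[OF that(1)] mono[OF that(2)] N
        by linarith
      then show ?thesis using \<open>0 < e\<close> by (simp add: dist_norm power2_less_imp_less)
    qed
    then show "\<exists>M. \<forall>i\<ge>M. \<forall>j\<ge>M. dist (X i) (X j) < e" by blast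
  qed
  then obtain y where y: "X \<longlonglongrightarrow> y" using Cauchy_convergent convergent_def by blast
  have "y \<in> S" using closed_sequentially[OF S(2)] X(1) y by blast
  have "(\<lambda>n. q (X n)) \<longlonglongrightarrow> q y"
    unfolding q_def by (intro tendsto_intros y f.tendsto)
  moreover have "(\<lambda>n. m + inverse (real (Suc n))) \<longlonglongrightarrow> m + 0"
    by (intro tendsto_intros LIMSEQ_inverse_real_of_nat)
  ultimately have "q y \<le> m + 0"
    using X(2) by (intro LIMSEQ_le[of "\<lambda>n. q (X n)"]) (auto intro: less_imp_le)
  then have minimal: "q y \<le> q s" if "s \<in> S" for s using m_le[OF that] by simp
  have Re_eq: "Re (f s) = Re (cinner s y)" if "s \<in> S" for s
  proof -
    define d where "d = Re (cinner s y) - Re (f s)"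
    have quadratic: "0 \<le> t\<^sup>2 * (norm s)\<^sup>2 + 2 * t * d" for t
    proof -
      have "y + t *\<^sub>R s \<in> S" using \<open>y \<in> S\<close> that S(1) by (simp add: subspace_add subspace_scale)
      from minimal[OF this] show ?thesis
        using arg_cong[OF cinner_commute[of y s], of Re]
        by (simp add: q_def norm_add_squared f.add f.scaleR cinner.scaleR_right d_def
            power_mult_distrib algebra_simps)
    qed
    have pos: "0 < (norm s)\<^sup>2 + 1" by (intro add_nonneg_pos) auto
    (* The optimal step is - d / (norm s)^2; adding 1 avoids a separate case s = 0. *)
    define t where "t = - d / ((norm s)\<^sup>2 + 1)"
    have "t\<^sup>2 * (norm s)\<^sup>2 + 2 * t * d = - (d\<^sup>2 * ((norm s)\<^sup>2 + 2)) / ((norm s)\<^sup>2 + 1)\<^sup>2"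
      using pos unfolding t_def
      by (simp add: divide_simps) (simp add: algebra_simps power2_eq_square)
    with quadratic[of t] have "d\<^sup>2 * ((norm s)\<^sup>2 + 2) / ((norm s)\<^sup>2 + 1)\<^sup>2 \<le> 0" by simp
    moreover have "((norm s)\<^sup>2 + 2) / ((norm s)\<^sup>2 + 1)\<^sup>2 > 0"
      using pos by (intro divide_pos_pos add_nonneg_pos zero_less_power) auto
    ultimately have "d\<^sup>2 \<le> 0"
      by (metis mult_le_0_iff not_le times_divide_eq_right)
    then show ?thesis by (simp add: d_def)
  qed
  (* The imaginary parts agree because S is closed under multiplication by \<i>. *)
  have "f s = cinner s y" if "s \<in> S" for s
    using Re_eq[OF that] Re_eq[OF S_scaleC[OF that, of \<i>]]
    by (simp add: complex_eq_iff f_scaleC cinner.scaleC_left)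
  with \<open>y \<in> S\<close> show thesis by (rule that)
qed

text \<open>
  The definite description that defines the adjoint denotes by Riesz representation of the
  functionals \<open>\<lambda>x. cinner (T x) y\<close>.
\<close>
lemma cadjoint_eq:
  assumes T: "bounded_clinear T"
  shows "cinner (T x) y = cinner x (cadjoint T y)"
proof -
  have "\<exists>z. \<forall>x. cinner (T x) y = cinner x z" for y
  proof -
    have "bounded_linear (\<lambda>x. cinner (T x) y)"
      using T bounded_linear_compose[OF bounded_linear_cinner_left]
      unfolding bounded_clinear_def by blast
    moreover have "cinner (T (c *\<^sub>C x)) y = c * cinner (T x) y" for c x
      using T by (simp add: bounded_clinear_def cinner.scaleC_left)
    ultimately obtain z where "\<And>x. x \<in> UNIV \<Longrightarrow> cinner (T x) y = cinner x z"
      using Riesz_on_closed_subspace[of UNIV "\<lambda>x. cinner (T x) y"] by auto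
    then show ?thesis by blast
  qed
  then obtain S where S: "\<forall>x y. cinner (T x) y = cinner x (S y)" by metis
  have "\<exists>!S. \<forall>x y. cinner (T x) y = cinner x (S y)"
  proof (rule ex1I[of _ S])
    fix S' assume "\<forall>x y. cinner (T x) y = cinner x (S' y)"
    with S show "S' = S" by (metis cinner_eqI ext)
  qed (rule S)
  from theI'[OF this] show ?thesis unfolding cadjoint_def by blast
qed

section \<open>The seminorm of a positive operator\<close>

text \<open>
  Polarisation: the quadratic form is real at \<open>x + y\<close> and at \<open>x + \<i> y\<close>, which fixes the
  imaginary and the real part of the symmetry.
\<close>
lemma positive_operator_hermitian:
  assumes "positive_operator A"
  shows "cinner (A x) y = cinner x (A y)"
proof -
  have lin: "A (x + y) = A x + A y" "A (c *\<^sub>C x) = c *\<^sub>C A x" for x y c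
    using assms
    by (simp_all add: positive_operator_def bounded_clinear_def bounded_linear.linear linear_add)
  have real: "Im (cinner (A x) x) = 0" for x
    using assms by (simp add: positive_operator_def complex_nonneg_Reals_iff)
  let ?b = "\<lambda>x y. cinner (A x) y"
  have "Im (?b x y) + Im (?b y x) = 0"
    using real[of "x + y"] real[of x] real[of y]
    by (simp add: lin cinner.add_left cinner.add_right)
  moreover have "Re (?b y x) = Re (?b x y)"
    using real[of "x + \<i> *\<^sub>C y"] real[of x] real[of y]
    by (simp add: lin cinner.add_left cinner.add_right cinner.scaleC_left cinner.scaleC_right)
  ultimately have "?b x y = cnj (?b y x)" by (simp add: complex_eq_iff)
  then show ?thesis using cinner_commute[of x "A y"] by simp
qed

locale semi_hilbertian =
  fixes A :: "'a::chilbert_space \<Rightarrow> 'a"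
  assumes positive: "positive_operator A"
begin

lemma A_bounded_linear: "bounded_linear A"
  and A_scaleC: "A (c *\<^sub>C x) = c *\<^sub>C A x"
  using positive by (simp_all add: positive_operator_def bounded_clinear_def)

sublocale form: positive_form "A_inner A"
proof
  fix x y z and c
  show "A_inner A (x + y) z = A_inner A x z + A_inner A y z"
    by (simp add: A_inner_def linear_add[OF bounded_linear.linear[OF A_bounded_linear]]
        cinner.add_left)
  show "A_inner A (c *\<^sub>C x) y = c * A_inner A x y"
    by (simp add: A_inner_def A_scaleC cinner.scaleC_left)
  show "A_inner A x y = cnj (A_inner A y x)"
    unfolding A_inner_def positive_operator_hermitian[OF positive, of x y] by (rule cinner_commute)
  show "0 \<le> Re (A_inner A x x)"
    using positive by (simp add: A_inner_def positive_operator_def complex_nonneg_Reals_iff)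
qed

lemma A_norm_nonneg: "0 \<le> A_norm A x"
  by (simp add: A_norm_def form.nonneg)

lemma A_norm_squared: "(A_norm A x)\<^sup>2 = Re (A_inner A x x)"
  by (simp add: A_norm_def form.nonneg)

lemma A_inner_le: "cmod (A_inner A x y) \<le> A_norm A x * A_norm A y"
  using form.Cauchy_Schwarz by (simp add: A_norm_def)

text \<open>Vectors of seminorm \<open>0\<close> are orthogonal to everything, by the Cauchy-Schwarz inequality.\<close>
lemma A_norm_add_null:
  assumes "A_norm A z = 0"
  shows "A_norm A (x + z) = A_norm A x"
proof -
  have "A_inner A u z = 0" "A_inner A z u = 0" for u
    using A_inner_le[of u z] A_inner_le[of z u] assms by simp_all
  then show ?thesis by (simp add: A_norm_def form.add_left form.add_right)
qed

lemma A_norm_le_norm: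
  obtains C where "\<And>x. A_norm A x \<le> C * norm x"
proof -
  obtain K where K: "0 \<le> K" "\<And>x. norm (A x) \<le> norm x * K"
    using bounded_linear.nonneg_bounded[OF A_bounded_linear] by blast
  have "A_norm A x \<le> sqrt K * norm x" for x
  proof (rule power2_le_imp_le)
    have "(A_norm A x)\<^sup>2 \<le> norm (A x) * norm x"
      unfolding A_norm_squared A_inner_def
      using complex_Re_le_cmod cinner_bound order_trans by blast
    also have "\<dots> \<le> (norm x * K) * norm x" using K(2) by (intro mult_right_mono) auto
    finally show "(A_norm A x)\<^sup>2 \<le> (sqrt K * norm x)\<^sup>2"
      using K(1) by (simp add: power_mult_distrib) (simp add: power2_eq_square mult_ac)
  qed (use K(1) in simp)
  then show thesis by (rule that)
qed

text \<open>
  For symmetric \<open>S\<close> the sequence \<open>a k = \<parallel>S\<^sup>k x\<parallel>\<^sub>A\<close> is logarithmically convex, so it grows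
  at least like \<open>(a 1 / a 0)\<^sup>k\<close>. As the seminorm is dominated by the norm, it grows at most
  like \<open>M\<^sup>k\<close>; hence \<open>a 1 / a 0 \<le> M\<close>.
\<close>
lemma A_symmetric_bounded:
  assumes S: "\<And>x y. A_inner A (S x) y = A_inner A x (S y)"
    and M: "0 < M" "\<And>x. norm (S x) \<le> norm x * M"
  shows "A_norm A (S x) \<le> M * A_norm A x"
proof (rule ccontr)
  assume contra: "\<not> ?thesis"
  define a where "a k = A_norm A ((S ^^ k) x)" for k
  have a_nonneg: "0 \<le> a k" for k by (simp add: a_def A_norm_nonneg)
  have log_convex: "(a (Suc k))\<^sup>2 \<le> a k * a (Suc (Suc k))" for k
  proof -
    have "(a (Suc k))\<^sup>2 = Re (A_inner A ((S ^^ k) x) ((S ^^ Suc (Suc k)) x))"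
      by (simp add: a_def A_norm_squared S)
    also have "\<dots> \<le> a k * a (Suc (Suc k))"
      unfolding a_def using complex_Re_le_cmod A_inner_le order_trans by blast
    finally show ?thesis .
  qed
  have a1: "M * a 0 < a 1" using contra by (simp add: a_def)
  then have "0 < a 1"
    using mult_nonneg_nonneg[of M "a 0"] M(1) a_nonneg[of 0] by linarith
  then have a0: "0 < a 0" using log_convex[of 0] a_nonneg[of 0]
    by (cases "a 0 = 0") auto
  define r where "r = a 1 / a 0"
  have "M < r" using a1 a0 by (simp add: r_def field_simps)
  have ratio: "0 < a k \<and> r * a k \<le> a (Suc k)" for k
  proof (induction k)
    case 0
    then show ?case using a0 by (simp add: r_def)
  next
    case (Suc k)
    have pos: "0 < a (Suc k)"
      using Suc \<open>M < r\<close> M(1) by (smt (verit) mult_pos_pos)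
    have "a k * (r * a (Suc k)) = (r * a k) * a (Suc k)" by simp
    also have "\<dots> \<le> a (Suc k) * a (Suc k)" using Suc pos by (intro mult_right_mono) auto
    also have "\<dots> \<le> a k * a (Suc (Suc k))" using log_convex[of k] by (simp add: power2_eq_square)
    finally show ?case using Suc pos by simp
  qed
  have lower: "r ^ k * a 0 \<le> a k" for k
  proof (induction k)
    case (Suc k)
    have "r ^ Suc k * a 0 \<le> r * a k"
      using Suc \<open>M < r\<close> M(1) by (simp add: mult.assoc mult_left_mono)
    then show ?case using ratio[of k] by linarith
  qed simp
  have norm_power: "norm ((S ^^ k) x) \<le> M ^ k * norm x" for k
  proof (induction k)
    case (Suc k)
    have "norm ((S ^^ Suc k) x) \<le> norm ((S ^^ k) x) * M" using M(2) by simp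
    also have "\<dots> \<le> (M ^ k * norm x) * M" using Suc M(1) by (intro mult_right_mono) auto
    finally show ?case by (simp add: mult_ac)
  qed simp
  obtain C where C: "\<And>x. A_norm A x \<le> C * norm x" by (rule A_norm_le_norm) blast
  have "(r / M) ^ k \<le> \<bar>C\<bar> * norm x / a 0" for k
  proof -
    have "r ^ k * a 0 \<le> \<bar>C\<bar> * norm ((S ^^ k) x)"
      using lower[of k] C[of "(S ^^ k) x"] unfolding a_def
      by (smt (verit) mult_right_mono norm_ge_zero)
    also have "\<dots> \<le> \<bar>C\<bar> * (M ^ k * norm x)"
      by (intro mult_left_mono norm_power) auto
    finally show ?thesis using a0 M(1) by (simp add: power_divide field_simps)
  qed
  moreover have "1 < r / M" using \<open>M < r\<close> M(1) by simp
  ultimately show False using real_arch_pow[of "r / M" "\<bar>C\<bar> * norm x / a 0"] not_less by blast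
qed

text \<open>
  If \<open>A X = T\<^sup>* A\<close> then \<open>X\<close> is adjoint to \<open>T\<close> for the semi-inner product, and
  \<open>\<parallel>T x\<parallel>\<^sub>A\<^sup>2 = \<langle>X T x, x\<rangle>\<^sub>A\<close>, where \<open>X T\<close> is symmetric.
\<close>
lemma A_bounded:
  assumes "T \<in> A_bounded_operators A"
  obtains c where "0 \<le> c" "\<And>x. A_norm A (T x) \<le> c * A_norm A x"
proof -
  from assms obtain X where T: "bounded_clinear T" and X: "bounded_clinear X"
    and AX: "A \<circ> X = cadjoint T \<circ> A"
    unfolding A_bounded_operators_def by blast
  have TX: "A_inner A (T x) y = A_inner A x (X y)" for x y
  proof -
    have "A_inner A (T x) y = cinner (T x) (A y)"
      by (simp add: A_inner_def positive_operator_hermitian[OF positive])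
    also have "\<dots> = cinner x (A (X y))"
      using AX by (simp add: cadjoint_eq[OF T] fun_eq_iff)
    finally show ?thesis by (simp add: A_inner_def positive_operator_hermitian[OF positive])
  qed
  have XT: "A_inner A (X x) y = A_inner A x (T y)" for x y
    using TX[of y x] form.commute by metis
  have "bounded_linear (\<lambda>x. X (T x))"
    using T X bounded_linear_compose unfolding bounded_clinear_def by blast
  then obtain M where M: "0 < M" "\<And>x. norm (X (T x)) \<le> norm x * M"
    using bounded_linear.pos_bounded by blast
  have "A_norm A (T x) \<le> sqrt M * A_norm A x" for x
  proof (rule power2_le_imp_le)
    have "(A_norm A (T x))\<^sup>2 \<le> cmod (A_inner A (X (T x)) x)"
      unfolding A_norm_squared XT by (rule complex_Re_le_cmod)
    also have "\<dots> \<le> A_norm A (X (T x)) * A_norm A x" by (rule A_inner_le)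
    also have "\<dots> \<le> (M * A_norm A x) * A_norm A x"
      using M A_norm_nonneg
      by (intro mult_right_mono A_symmetric_bounded[of "\<lambda>x. X (T x)"]) (auto simp: TX XT)
    finally show "(A_norm A (T x))\<^sup>2 \<le> (sqrt M * A_norm A x)\<^sup>2"
      using M(1) by (simp add: power_mult_distrib) (simp add: power2_eq_square mult_ac)
  qed (use M(1) A_norm_nonneg in simp)
  then show thesis using M(1) by (intro that[of "sqrt M"]) auto
qed

text \<open>
  Here \<open>y\<close> is the orthogonal projection of \<open>x\<close> to the closed range; the remainder is orthogonal
  to the range of the self-adjoint operator \<open>A\<close>, hence in its kernel.
\<close>
lemma range_kernel_decomposition:
  obtains y z where "x = y + z" "y \<in> closure (range A)" "A z = 0"
proof -
  let ?S = "closure (range A)"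
  have range_add: "u + v \<in> range A" if "u \<in> range A" "v \<in> range A" for u v
    using that bounded_linear.linear[OF A_bounded_linear] by (auto simp flip: linear_add)
  have add: "s + t \<in> ?S" if "s \<in> ?S" "t \<in> ?S" for s t
  proof -
    from that obtain f g where f: "\<forall>n. f n \<in> range A" "f \<longlonglongrightarrow> s"
      and g: "\<forall>n. g n \<in> range A" "g \<longlonglongrightarrow> t"
      unfolding closure_sequential by blast
    have "f n + g n \<in> range A" for n
      by (rule range_add[OF f(1)[rule_format] g(1)[rule_format]])
    moreover have "(\<lambda>n. f n + g n) \<longlonglongrightarrow> s + t" by (rule tendsto_add[OF f(2) g(2)])
    ultimately show ?thesis unfolding closure_sequential by (intro exI[of _ "\<lambda>n. f n + g n"]) simp
  qed
  have scale: "c *\<^sub>C s \<in> ?S" if "s \<in> ?S" for c s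
  proof -
    have "(*\<^sub>C) c ` ?S \<subseteq> ?S"
    proof (rule image_closure_subset)
      show "continuous_on ?S ((*\<^sub>C) c)"
        by (rule linear_continuous_on[OF bounded_linear_scaleC])
      show "(*\<^sub>C) c ` range A \<subseteq> ?S"
        using closure_subset by (force simp flip: A_scaleC)
    qed simp
    with that show ?thesis by blast
  qed
  have "A 0 \<in> ?S" by (rule subsetD[OF closure_subset rangeI])
  then have "0 \<in> ?S"
    by (simp add: linear_0[OF bounded_linear.linear[OF A_bounded_linear]])
  then have "subspace ?S" by (simp add: subspace_def add scale scaleR_scaleC)
  then obtain y where y: "y \<in> ?S" "\<And>s. s \<in> ?S \<Longrightarrow> cinner s x = cinner s y"
    by (rule Riesz_on_closed_subspace[of ?S "\<lambda>s. cinner s x"])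
      (use scale bounded_linear_cinner_left in \<open>simp_all add: cinner.scaleC_left\<close>)
  have "A x = A y"
  proof (rule cinner_eqI)
    fix w
    have "cinner (A w) x = cinner (A w) y" by (rule y(2)[OF subsetD[OF closure_subset rangeI]])
    then show "cinner w (A x) = cinner w (A y)"
      by (simp add: positive_operator_hermitian[OF positive])
  qed
  then have "A (x - y) = 0"
    using linear_diff[OF bounded_linear.linear[OF A_bounded_linear]] by simp
  with y(1) show thesis by (intro that[of y "x - y"]) auto
qed

lemma A_opnorm_bdd_above:
  assumes "T \<in> A_bounded_operators A"
  shows "bdd_above (insert 0 {A_norm A (T x) / A_norm A x | x. x \<in> closure (range A) \<and> x \<noteq> 0})"
proof -
  obtain c where c: "0 \<le> c" "\<And>x. A_norm A (T x) \<le> c * A_norm A x"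
    using A_bounded[OF assms] by blast
  have "A_norm A (T x) / A_norm A x \<le> c" for x
    using c A_norm_nonneg[of x] by (cases "A_norm A x = 0") (simp_all add: divide_le_eq)
  with c(1) show ?thesis by (auto intro: bdd_aboveI[of _ c])
qed

lemma A_opnorm_nonneg:
  assumes "T \<in> A_bounded_operators A"
  shows "0 \<le> A_opnorm A T"
  unfolding A_opnorm_def using A_opnorm_bdd_above[OF assms] by (intro cSup_upper) auto

text \<open>
  By the decomposition, \<open>x\<close> may be replaced by its component in the closed range: the
  kernel component has seminorm \<open>0\<close>, and so has its image, by boundedness of \<open>T\<close>. Quotients
  with denominator \<open>0\<close>, which equal \<open>0\<close> here, carry no information and are treated separately.
\<close>
lemma A_norm_le_A_opnorm:
  assumes "T \<in> A_bounded_operators A"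
  shows "A_norm A (T x) \<le> A_opnorm A T * A_norm A x"
proof -
  obtain c where c: "\<And>x. A_norm A (T x) \<le> c * A_norm A x"
    using A_bounded[OF assms] by blast
  have null: "A_norm A (T u) = 0" if "A_norm A u = 0" for u
    using c[of u] that A_norm_nonneg[of "T u"] by simp
  obtain y z where x: "x = y + z" and y: "y \<in> closure (range A)" and z: "A z = 0"
    by (rule range_kernel_decomposition)
  have "A_norm A z = 0" by (simp add: A_norm_def A_inner_def z cinner.zero_left)
  moreover have "T x = T y + T z"
    using assms unfolding x A_bounded_operators_def bounded_clinear_def
    by (simp add: bounded_linear.linear linear_add)
  ultimately have x_y: "A_norm A x = A_norm A y" "A_norm A (T x) = A_norm A (T y)"
    by (simp_all add: x A_norm_add_null null)
  show ?thesis
  proof (cases "A_norm A y = 0")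
    case True
    then show ?thesis by (simp add: x_y null)
  next
    case False
    then have "y \<noteq> 0" by (auto simp: A_norm_def form.zero_left)
    with y have "A_norm A (T y) / A_norm A y \<le> A_opnorm A T"
      unfolding A_opnorm_def using A_opnorm_bdd_above[OF assms] by (intro cSup_upper) auto
    then show ?thesis using False A_norm_nonneg[of y] by (simp add: x_y divide_le_eq)
  qed
qed

lemma A_inner_le_A_opnorm:
  assumes "T \<in> A_bounded_operators A"
  shows "cmod (A_inner A (T x) y) \<le> A_opnorm A T * A_norm A x * A_norm A y"
  using A_inner_le[of "T x" y] A_norm_le_A_opnorm[OF assms, of x] A_norm_nonneg[of y]
  by (meson mult_right_mono order_trans)

lemma A_numerical_radius_bdd_above:
  assumes "T \<in> A_bounded_operators A"
  shows "bdd_above (insert 0 {cmod (A_inner A (T x) x) | x. A_norm A x = 1})"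
proof -
  have "cmod (A_inner A (T x) x) \<le> A_opnorm A T" if "A_norm A x = 1" for x
    using A_inner_le_A_opnorm[OF assms, of x x] that by simp
  then show ?thesis
    using A_opnorm_nonneg[OF assms] by (auto intro: bdd_aboveI[of _ "A_opnorm A T"])
qed

lemma A_numerical_radius_nonneg:
  assumes "T \<in> A_bounded_operators A"
  shows "0 \<le> A_numerical_radius A T"
  unfolding A_numerical_radius_def
  using A_numerical_radius_bdd_above[OF assms] by (intro cSup_upper) auto

lemma A_inner_le_A_numerical_radius:
  assumes "T \<in> A_bounded_operators A" "A_norm A x = 1"
  shows "cmod (A_inner A (T x) x) \<le> A_numerical_radius A T"
  unfolding A_numerical_radius_def
  using A_numerical_radius_bdd_above[OF assms(1)] assms(2) by (intro cSup_upper) auto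

section \<open>Operator matrices\<close>

lemma A_inner_block_diag: "A_inner (block_diag A) u v = (\<Sum>j\<in>UNIV. A_inner A (u $ j) (v $ j))"
proof -
  have "block_diag A u $ j = A (u $ j)" for j
  proof -
    have "block_diag A u $ j = (\<Sum>k\<in>UNIV. if j = k then A (u $ k) else 0)"
      unfolding block_diag_def operator_matrix_def vec_lambda_beta by (intro sum.cong) auto
    then show ?thesis by simp
  qed
  then show ?thesis by (simp add: A_inner_def cinner_vec_def)
qed

lemma A_norm_block_diag: "(A_norm (block_diag A) x)\<^sup>2 = (\<Sum>j\<in>UNIV. (A_norm A (x $ j))\<^sup>2)"
proof -
  have "Re (A_inner (block_diag A) x x) = (\<Sum>j\<in>UNIV. (A_norm A (x $ j))\<^sup>2)"
    by (simp only: A_inner_block_diag Re_sum A_norm_squared)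
  moreover have "0 \<le> (\<Sum>j\<in>UNIV. (A_norm A (x $ j))\<^sup>2)" by (intro sum_nonneg) simp
  ultimately show ?thesis by (simp only: A_norm_def[of "block_diag A"] real_sqrt_pow2)
qed

text \<open>
  A Schur test with constant weights. Splitting each product \<open>a\<^sub>j a\<^sub>k\<close> into squares turns the
  double sum into weighted row sums and column sums, which agree as the bounds on the entries are
  symmetric.
\<close>
lemma numerical_radius_operator_matrix_le:
  fixes M :: "('a \<Rightarrow> 'a) ^ 'n::finite ^ 'n"
  assumes entry: "\<And>j k u v. cmod (A_inner A ((M $ j $ k) u) v) \<le> C j k * A_norm A u * A_norm A v"
    and nonneg: "\<And>j k. 0 \<le> C j k" and sym: "\<And>j k. C j k = C k j"
    and row: "\<And>j. (\<Sum>k\<in>UNIV. C j k) \<le> R"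
  shows "A_numerical_radius (block_diag A) (operator_matrix M) \<le> R"
  unfolding A_numerical_radius_def
proof (rule cSup_least)
  have "0 \<le> R" by (rule order_trans[OF sum_nonneg row]) (rule nonneg)
  moreover have "cmod (A_inner (block_diag A) (operator_matrix M x) x) \<le> R"
    if "A_norm (block_diag A) x = 1" for x
  proof -
    define a where "a j = A_norm A (x $ j)" for j
    have unit: "(\<Sum>j\<in>UNIV. (a j)\<^sup>2) = 1"
      using A_norm_block_diag[of x] that by (simp add: a_def)
    have "A_inner (block_diag A) (operator_matrix M x) x
        = (\<Sum>j\<in>UNIV. \<Sum>k\<in>UNIV. A_inner A ((M $ j $ k) (x $ k)) (x $ j))"
      by (simp add: A_inner_block_diag operator_matrix_def form.sum_left)
    also have "cmod \<dots> \<le> (\<Sum>j\<in>UNIV. \<Sum>k\<in>UNIV. cmod (A_inner A ((M $ j $ k) (x $ k)) (x $ j)))"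
      by (intro order_trans[OF norm_sum] sum_mono norm_sum)
    also have "\<dots> \<le> (\<Sum>j\<in>UNIV. \<Sum>k\<in>UNIV. C j k * (a j)\<^sup>2 / 2 + C j k * (a k)\<^sup>2 / 2)"
    proof (intro sum_mono)
      fix j k
      have "a k * a j \<le> (a j)\<^sup>2 / 2 + (a k)\<^sup>2 / 2"
        using sum_squares_bound[of "a k" "a j"] by simp
      from mult_left_mono[OF this nonneg[of j k]] entry[of j k "x $ k" "x $ j"]
      show "cmod (A_inner A ((M $ j $ k) (x $ k)) (x $ j)) \<le> C j k * (a j)\<^sup>2 / 2 + C j k * (a k)\<^sup>2 / 2"
        by (simp add: a_def algebra_simps)
    qed
    also have "\<dots> = (\<Sum>j\<in>UNIV. \<Sum>k\<in>UNIV. C j k * (a j)\<^sup>2 / 2)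
        + (\<Sum>j\<in>UNIV. \<Sum>k\<in>UNIV. C j k * (a k)\<^sup>2 / 2)"
      by (simp add: sum.distrib)
    also have "(\<Sum>j\<in>UNIV. \<Sum>k\<in>UNIV. C j k * (a k)\<^sup>2 / 2) = (\<Sum>j\<in>UNIV. \<Sum>k\<in>UNIV. C j k * (a j)\<^sup>2 / 2)"
      by (subst sum.swap) (simp add: sym)
    also have "(\<Sum>j\<in>UNIV. \<Sum>k\<in>UNIV. C j k * (a j)\<^sup>2 / 2) + (\<Sum>j\<in>UNIV. \<Sum>k\<in>UNIV. C j k * (a j)\<^sup>2 / 2)
        = (\<Sum>j\<in>UNIV. (\<Sum>k\<in>UNIV. C j k) * (a j)\<^sup>2)"
      by (simp add: sum_distrib_right flip: sum.distrib)
    also have "\<dots> \<le> (\<Sum>j\<in>UNIV. R * (a j)\<^sup>2)"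
      by (intro sum_mono mult_right_mono row) auto
    also have "\<dots> = R" using unit by (simp flip: sum_distrib_left)
    finally show ?thesis .
  qed
  ultimately show "r \<le> R"
    if "r \<in> insert 0 {cmod (A_inner (block_diag A) (operator_matrix M x) x) | x.
        A_norm (block_diag A) x = 1}" for r
    using that by auto
qed simp

end

section \<open>Skew left circulant matrices\<close>

lemma pos_bounds: "1 \<le> pos j" "pos (j::'n::{finite,linorder}) \<le> CARD('n)"
proof -
  have "card {j} \<le> pos j" unfolding pos_def by (intro card_mono) auto
  then show "1 \<le> pos j" by simp
  show "pos j \<le> CARD('n)" unfolding pos_def by (intro card_mono) auto
qed

lemma inj_pos: "inj (pos :: 'n::{finite,linorder} \<Rightarrow> nat)"
proof -
  have "pos i < pos j" if "i < j" for i j :: 'n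
    unfolding pos_def by (intro psubset_card_mono) (use that in \<open>force simp: psubset_eq set_eq_iff\<close>)+
  then have "strict_mono (pos :: 'n \<Rightarrow> nat)" by (rule strict_monoI)
  then show ?thesis by (rule strict_mono_imp_inj_on)
qed

text \<open>
  The residue of \<open>pos j + pos k - 1\<close> modulo \<open>n\<close>, represented in \<open>{1, \<dots>, n}\<close>: the index of
  the operator that stands, up to sign, at \<open>(j, k)\<close>.
\<close>
definition slcirc_index :: "'n::{finite,linorder} \<Rightarrow> 'n \<Rightarrow> nat"
  where "slcirc_index j k = (if pos j + pos k \<le> CARD('n) + 1
    then pos j + pos k - 1 else pos j + pos k - 1 - CARD('n))"

lemma slcirc_index_commute: "slcirc_index j k = slcirc_index k j"
  by (simp add: slcirc_index_def add.commute)

lemma slcirc_index_bij: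
  fixes j :: "'n::{finite,linorder}"
  shows "bij_betw (slcirc_index j) UNIV {1..CARD('n)}"
proof -
  have range: "slcirc_index j k \<in> {1..CARD('n)}" for k
    using pos_bounds[of j] pos_bounds[of k] by (auto simp: slcirc_index_def)
  have inj: "inj (slcirc_index j)"
  proof (rule injI)
    fix k l assume "slcirc_index j k = slcirc_index j l"
    then have "pos k = pos l"
      using pos_bounds[of j] pos_bounds[of k] pos_bounds[of l]
      by (auto simp: slcirc_index_def split: if_splits)
    then show "k = l" by (rule injD[OF inj_pos])
  qed
  moreover have "range (slcirc_index j) = {1..CARD('n)}"
    using range by (intro card_subset_eq) (auto simp: card_image[OF inj])
  ultimately show ?thesis by (simp add: bij_betw_def)
qed

text \<open>
  The Schur test applies with the seminorms of the entries as weights. The signs disappear, and each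
  row sum is the sum over all the operators, as a row is a permutation of them.
\<close>
lemma slcirc_numerical_radius_le:
  fixes T :: "nat \<Rightarrow> 'a::chilbert_space \<Rightarrow> 'a"
  assumes "positive_operator A"
    and T: "\<And>i. i \<in> {1..CARD('n::{finite,linorder})} \<Longrightarrow> T i \<in> A_bounded_operators A"
  shows "A_numerical_radius (block_diag A) (slcirc T :: ('a, 'n) vec \<Rightarrow> ('a, 'n) vec)
    \<le> (\<Sum>i=1..CARD('n). A_opnorm A (T i))"
proof -
  interpret semi_hilbertian A by standard fact
  let ?m = "slcirc_index :: 'n \<Rightarrow> 'n \<Rightarrow> nat"
  have T_entry: "T (?m j k) \<in> A_bounded_operators A" for j k
    using T bij_betwE[OF slcirc_index_bij, of j] by blast
  have minus: "A_inner A (- u) v = - A_inner A u v" for u v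
    using form.scaleR_left[of "-1" u v] by simp
  show ?thesis
    unfolding slcirc_def
  proof (rule numerical_radius_operator_matrix_le[where C = "\<lambda>j k. A_opnorm A (T (?m j k))"])
    fix j k :: 'n and u v
    show "0 \<le> A_opnorm A (T (?m j k))" by (rule A_opnorm_nonneg[OF T_entry])
    show "A_opnorm A (T (?m j k)) = A_opnorm A (T (?m k j))"
      by (simp add: slcirc_index_commute)
    show "(\<Sum>k\<in>UNIV. A_opnorm A (T (?m j k))) \<le> (\<Sum>i=1..CARD('n). A_opnorm A (T i))"
      using sum.reindex_bij_betw[OF slcirc_index_bij[of j], of "\<lambda>i. A_opnorm A (T i)"] by simp
    show "cmod (A_inner A (((\<chi> j k. if pos j + pos k \<le> CARD('n) + 1 then T (pos j + pos k - 1)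
        else (\<lambda>x. - T (pos j + pos k - 1 - CARD('n)) x)) $ j $ k) u) v)
      \<le> A_opnorm A (T (?m j k)) * A_norm A u * A_norm A v"
      using A_inner_le_A_opnorm[OF T_entry[of j k], of u v]
      by (simp add: slcirc_index_def minus split: if_splits)
  qed
qed

theorem corollary3p3:
  fixes A :: "'a::chilbert_space \<Rightarrow> 'a"
    and T :: "nat \<Rightarrow> 'a \<Rightarrow> 'a"
  assumes "positive_operator A"
    and "\<forall>i\<in>{1..CARD('n::{finite,linorder})}. T i \<in> A_bounded_operators A"
  shows "(even CARD('n) \<longrightarrow>
      A_numerical_radius (block_diag A) (slcirc T :: ('a, 'n) vec \<Rightarrow> ('a, 'n) vec)
        \<le> real CARD('n) / 2 * (\<Sum>i=1..CARD('n). A_opnorm A (T i))) \<and>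
    (odd CARD('n) \<longrightarrow>
      A_numerical_radius (block_diag A) (slcirc T :: ('a, 'n) vec \<Rightarrow> ('a, 'n) vec)
        \<le> (\<Sum>i=1..CARD('n). A_numerical_radius A (T i))
          + (real CARD('n) - 1) / 2 * (\<Sum>i=1..CARD('n). A_opnorm A (T i)))"
proof -
  interpret semi_hilbertian A by standard fact
  let ?n = "CARD('n)" and ?S = "slcirc T :: ('a, 'n) vec \<Rightarrow> ('a, 'n) vec"
  define N where "N = (\<Sum>i=1..?n. A_opnorm A (T i))"
  define W where "W = (\<Sum>i=1..?n. A_numerical_radius A (T i))"
  have N: "0 \<le> N" unfolding N_def using assms(2) by (intro sum_nonneg A_opnorm_nonneg) blast
  have W: "0 \<le> W" unfolding W_def using assms(2) by (intro sum_nonneg A_numerical_radius_nonneg) blast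
  have bound: "A_numerical_radius (block_diag A) ?S \<le> N"
    unfolding N_def using assms by (intro slcirc_numerical_radius_le) auto
  have "A_numerical_radius (block_diag A) ?S \<le> real ?n / 2 * N" if "even ?n"
  proof -
    have "0 < ?n" by simp
    with that have "2 \<le> ?n" by presburger
    with mult_right_mono[OF _ N, of 1 "real ?n / 2"] bound show ?thesis by simp
  qed
  moreover have "A_numerical_radius (block_diag A) ?S \<le> W + (real ?n - 1) / 2 * N" if "odd ?n"
  proof (cases "?n = 1")
    case True
    have one: "pos j = 1" for j :: 'n using pos_bounds[of j] True by simp
    obtain o' :: 'n where univ: "UNIV = {o'}" using True by (rule card_1_singletonE)
    have entry: "?S x $ o' = T 1 (x $ o')" for x
      by (simp add: slcirc_def operator_matrix_def univ one)
    have T1: "T 1 \<in> A_bounded_operators A" using assms(2) True by simp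
    have "A_numerical_radius (block_diag A) ?S \<le> A_numerical_radius A (T 1)"
      unfolding A_numerical_radius_def[of "block_diag A"]
    proof (rule cSup_least)
      fix r
      assume "r \<in> insert 0 {cmod (A_inner (block_diag A) (?S x) x) | x. A_norm (block_diag A) x = 1}"
      then consider "r = 0"
        | x where "r = cmod (A_inner (block_diag A) (?S x) x)" "A_norm (block_diag A) x = 1"
        by blast
      then show "r \<le> A_numerical_radius A (T 1)"
      proof cases
        case 1
        then show ?thesis using A_numerical_radius_nonneg[OF T1] by simp
      next
        case 2
        then have "A_norm A (x $ o') = 1"
          using A_norm_block_diag[of x] A_norm_nonneg[of "x $ o'"] by (simp add: univ power2_eq_1_iff)
        from A_inner_le_A_numerical_radius[OF T1 this] 2 show ?thesis
          by (simp add: A_inner_block_diag univ entry)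
      qed
    qed simp
    then show ?thesis by (simp add: W_def True)
  next
    case False
    with that have "3 \<le> ?n" by presburger
    with mult_right_mono[OF _ N, of 1 "(real ?n - 1) / 2"] bound W show ?thesis by simp
  qed
  ultimately show ?thesis unfolding N_def W_def by blast
qed

end
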